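(* Let $T_1=(X_1,\rho_1,\mu_1)$ and $T_2=(X_2,\rho_2,\mu_2)$ be metric triples with non-degenerate measures $\mu_1,\mu_2$. Then $T_1$ and $T_2$ are equivalent if and only if their matrix distributions coincide, $D_{T_1}=D_{T_2}$, as measures on the cone $\mathcal{R}$ of infinite distance matrices.
   Context: A metric triple $T=(X,\rho,\mu)$ is a Polish (complete separable metric) space $(X,\rho)$ with a Borel probability measure $\mu$. The measure $\mu$ is non-degenerate if no nonempty open set has measure zero. Two metric triples $(X_1,\rho_1,\mu_1)$ and $(X_2,\rho_2,\mu_2)$ are equivalent if there is an isometry $V$ of $X_1$ onto $X_2$, $\rho_2(Vx,Vy)=\rho_1(x,y)$ for all $x,y\in X_1$, with $V\mu_1=\mu_2$ (image measure). $\mathcal{R}$ is the set of infinite real matrices $r=\{r_{i,j}\}_{i,j=1}^\infty$ with $r_{i,i}=0$, $r_{i,j}\ge 0$, $r_{i,j}=r_{j,i}$, $r_{i,k}+r_{k,j}\ge r_{i,j}$ for all $i,j,k$, with the topology (and Borel structure) induced from the product $\mathbb{R}^{\mathbb{N}^2}$. For a metric triple $T=(X,\rho,\mu)$ define $F_T:X^{\mathbb{N}}\to\mathcal{R}$ by $F_T(\{x_i\}_{i=1}^\infty)=\{\rho(x_i,x_j)\}_{i,j=1}^\infty$. The matrix distribution of $T$ is the image measure $D_T=F_T(\mu^{\mathbb{N}})$ on $\mathcal{R}$, where $\mu^{\mathbb{N}}$ is the infinite product (Bernoulli) measure on $X^{\mathbb{N}}$. *)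

theory Defs
  imports "HOL-Probability.Probability"
begin

text \<open>
  A metric triple \<open>(X, \<rho>, \<mu>)\<close> is a Borel probability measure \<open>\<mu>\<close> on a type of class
  \<^class>\<open>polish_space\<close>; the type carries \<open>X\<close> and its \<^const>\<open>dist\<close> is \<open>\<rho>\<close>, which this class
  requires to be complete and to induce the (second countable) topology.
\<close>

locale metric_triple = prob_space \<mu> for \<mu> :: "'a::polish_space measure" +
  assumes sets_eq_borel [measurable_cong]: "sets \<mu> = sets borel"

definition nondegenerate :: "'a::topological_space measure \<Rightarrow> bool" where
  "nondegenerate \<mu> \<longleftrightarrow> (\<forall>U. open U \<and> U \<noteq> {} \<longrightarrow> emeasure \<mu> U \<noteq> 0)"

definition equivalent_triples ::
    "'a::polish_space measure \<Rightarrow> 'b::polish_space measure \<Rightarrow> bool" where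
  "equivalent_triples \<mu>\<^sub>1 \<mu>\<^sub>2 \<longleftrightarrow>
     (\<exists>V. surj V \<and> (\<forall>x y. dist (V x) (V y) = dist x y) \<and> distr \<mu>\<^sub>1 borel V = \<mu>\<^sub>2)"

text \<open>Matrix entries are indexed from \<open>0\<close>.\<close>

definition distance_matrices :: "(nat \<Rightarrow> nat \<Rightarrow> real) set" where
  "distance_matrices =
     {r. (\<forall>i. r i i = 0) \<and> (\<forall>i j. r i j \<ge> 0) \<and> (\<forall>i j. r i j = r j i) \<and>
         (\<forall>i j k. r i k + r k j \<ge> r i j)}"

text \<open>
  The topology on \<^typ>\<open>nat \<Rightarrow> nat \<Rightarrow> real\<close> is the (iterated) product topology, so \<^const>\<open>borel\<close>
  is the Borel structure of the product of countably many real lines.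
\<close>

definition distance_matrix_space :: "(nat \<Rightarrow> nat \<Rightarrow> real) measure" where
  "distance_matrix_space = restrict_space borel distance_matrices"

definition distance_matrix :: "(nat \<Rightarrow> 'a::metric_space) \<Rightarrow> nat \<Rightarrow> nat \<Rightarrow> real" where
  "distance_matrix x = (\<lambda>i j. dist (x i) (x j))"

definition matrix_distribution :: "'a::polish_space measure \<Rightarrow> (nat \<Rightarrow> nat \<Rightarrow> real) measure" where
  "matrix_distribution \<mu> =
     distr (\<Pi>\<^sub>M i\<in>UNIV. \<mu>) distance_matrix_space distance_matrix"

text \<open>
  \<^const>\<open>distr\<close> is the image measure only along measurable maps, which the following facts ensure.
\<close>

lemma distance_matrix_in_distance_matrices: "distance_matrix x \<in> distance_matrices"
  by (auto simp: distance_matrices_def distance_matrix_def dist_commute intro: dist_triangle2)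

context metric_triple
begin

lemma measurable_distance_matrix:
  "distance_matrix \<in> measurable (\<Pi>\<^sub>M i\<in>UNIV. \<mu>) distance_matrix_space"
proof -
  have "distance_matrix \<in> borel_measurable (\<Pi>\<^sub>M i\<in>UNIV. \<mu>)"
    unfolding distance_matrix_def
    by (intro measurable_coordinatewise_then_product) measurable
  then show ?thesis
    unfolding distance_matrix_space_def
    by (intro measurable_restrict_space2) (auto simp: distance_matrix_in_distance_matrices)
qed

lemma prob_space_matrix_distribution: "prob_space (matrix_distribution \<mu>)"
proof -
  interpret P: product_prob_space "\<lambda>_::nat. \<mu>" UNIV ..
  show ?thesis
    unfolding matrix_distribution_def
    by (rule P.prob_space_distr) (rule measurable_distance_matrix)
qed

end

lemma isometry_borel_measurable:
  fixes V :: "'a::metric_space \<Rightarrow> 'b::metric_space"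
  assumes "\<And>x y. dist (V x) (V y) = dist x y"
  shows "V \<in> borel_measurable borel"
  by (intro borel_measurable_continuous_onI)
     (auto simp: continuous_on_iff assms)

end

theory Submission
  imports Defs
begin

text \<open>
  An isometry between the triples carries one product measure to the other and leaves distances
  alone, so equivalent triples have the same matrix distribution
  (\<open>matrix_distribution_isometry_invariant\<close>).

  For the converse, a sequence drawn independently from \<open>\<mu>\<close> almost surely remembers \<open>\<mu>\<close>: its
  empirical frequencies satisfy the lower bound \<open>liminf \<ge> \<mu> U\<close> on every open \<open>U\<close>, which is weak
  convergence of the empirical measures to \<open>\<mu>\<close>.  This follows from a strong law of large
  numbers for the countably many finite unions of basic open sets (\<open>AE_equidistributed\<close>).  Such an
  equidistributed sequence is dense when \<open>\<mu>\<close> is non-degenerate, and it is equidistributed for no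
  other measure (\<open>equidistributed_unique\<close>).

  If \<open>x\<close> and \<open>y\<close> are equidistributed sequences for \<open>\<mu>\<^sub>1\<close> and \<open>\<mu>\<^sub>2\<close> with the same distance matrix,
  then \<open>x i \<mapsto> y i\<close> is an isometry between dense sets and extends to an isometry \<open>V\<close> onto the second
  space (\<open>isometry_extension\<close>).  Then \<open>y = V \<circ> x\<close> is equidistributed both for \<open>\<mu>\<^sub>2\<close> and for the
  image of \<open>\<mu>\<^sub>1\<close>, so these two measures agree.

  It remains to find \<open>x\<close> and \<open>y\<close>.  The distance matrices of equidistributed sequences form, for
  each triple, a set of full outer measure, but two such sets could be disjoint if they were not
  measurable.  Inner regularity of the product measures settles this: each set of equidistributed
  sequences contains a compact set of measure above one half, whose image under the continuous map
  to matrices is again compact, hence measurable, and has probability above one half under the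
  common matrix distribution.  Two such images intersect (\<open>AE_common_value\<close>).
\<close>

section \<open>Equidistributed sequences\<close>

definition frequency :: "nat \<Rightarrow> (nat \<Rightarrow> 'a) \<Rightarrow> 'a set \<Rightarrow> real" where
  "frequency n x A = (\<Sum>i<n. indicator A (x i)) / real n"

text \<open>
  The portmanteau form of weak convergence of the empirical measures of \<open>x\<close> to \<open>M\<close>: on every
  open set the limes inferior of the frequencies is at least the measure.
\<close>

definition equidistributed :: "'a::topological_space measure \<Rightarrow> (nat \<Rightarrow> 'a) \<Rightarrow> bool" where
  "equidistributed M x \<longleftrightarrow>
     (\<forall>U e. open U \<and> e > 0 \<longrightarrow> (\<forall>\<^sub>F n in sequentially. frequency n x U > measure M U - e))"

lemma frequency_mono: "A \<subseteq> B \<Longrightarrow> frequency n x A \<le> frequency n x B"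
  unfolding frequency_def
  by (intro divide_right_mono sum_mono) (auto simp: indicator_def)

lemma frequency_Compl: "n > 0 \<Longrightarrow> frequency n x (- A) = 1 - frequency n x A"
  unfolding frequency_def by (simp add: indicator_compl sum_subtractf diff_divide_distrib)

lemma frequency_image: "frequency n (\<lambda>i. f (x i)) A = frequency n x (f -` A)"
  unfolding frequency_def by (simp add: indicator_def)

text \<open>Passing to complements turns the lower bound on open sets into an upper bound on closed sets.\<close>

lemma equidistributed_closed:
  assumes "prob_space M" "sets M = sets borel" "equidistributed M x" "closed C" "e > 0"
  shows "\<forall>\<^sub>F n in sequentially. frequency n x C < measure M C + e"
proof -
  interpret prob_space M by fact
  have sp: "space M = UNIV" using sets_eq_imp_space_eq[OF assms(2)] by simp
  have C: "C \<in> sets M" using assms by auto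
  have c: "measure M (- C) = 1 - measure M C"
    using prob_compl[OF C] by (simp add: sp Compl_eq_Diff_UNIV)
  have "\<forall>\<^sub>F n in sequentially. frequency n x (- C) > measure M (- C) - e"
    using assms(3-5) open_Compl unfolding equidistributed_def by blast
  then show ?thesis
    using eventually_gt_at_top[of 0]
    by eventually_elim (simp add: c frequency_Compl)
qed

text \<open>
  The frequencies bound \<open>M\<close> from above on open sets and \<open>N\<close> from below on closed sets.  To compare
  the two measures on \<open>U\<close>, exhaust \<open>U\<close> by open sets \<open>G k\<close> and insert closed sets
  \<open>G k \<subseteq> F k \<subseteq> U\<close>.
\<close>

lemma equidistributed_open_le:
  fixes M N :: "'a::metric_space measure"
  assumes "prob_space M" "sets M = sets borel" "equidistributed M x"
    and "prob_space N" "sets N = sets borel" "equidistributed N x" and U: "open U"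
  shows "measure M U \<le> measure N U"
proof (cases "U = UNIV")
  case True
  have "space M = UNIV" "space N = UNIV"
    using sets_eq_imp_space_eq[OF assms(2)] sets_eq_imp_space_eq[OF assms(5)] by simp_all
  then show ?thesis using True prob_space.prob_space[OF assms(1)] prob_space.prob_space[OF assms(4)] by simp
next
  case False
  interpret M: prob_space M by fact
  interpret N: prob_space N by fact
  \<comment> \<open>\<^const>\<open>infdist\<close> to the empty set is \<open>0\<close>, which is why \<open>U = UNIV\<close> is treated apart.\<close>
  define G where "G k = {z. infdist z (- U) > 1 / real (Suc k)}" for k
  define F where "F k = {z. infdist z (- U) \<ge> 1 / real (Suc k)}" for k
  have oG: "open (G k)" for k
    unfolding G_def by (intro open_Collect_less continuous_intros)
  have cF: "closed (F k)" for k
    unfolding F_def by (intro closed_Collect_le continuous_intros)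
  have FU: "F k \<subseteq> U" for k
  proof
    fix z assume z: "z \<in> F k"
    have "0 < 1 / real (Suc k)" by simp
    with z have "infdist z (- U) > 0" unfolding F_def by (metis mem_Collect_eq less_le_trans)
    then show "z \<in> U" using infdist_zero[of z "- U"] by fastforce
  qed
  have GF: "G k \<subseteq> F k" for k by (auto simp: G_def F_def)
  have UG: "(\<Union>k. G k) = U"
  proof
    show "(\<Union>k. G k) \<subseteq> U" using GF FU by blast
    show "U \<subseteq> (\<Union>k. G k)"
    proof
      fix z assume "z \<in> U"
      then have "infdist z (- U) > 0"
        using U False by (intro infdist_pos_not_in_closed) auto
      then obtain k where "1 / real (Suc k) < infdist z (- U)"
        using reals_Archimedean[of "infdist z (- U)"] by (auto simp: inverse_eq_divide)
      then show "z \<in> (\<Union>k. G k)" by (auto simp: G_def)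
    qed
  qed
  have inc: "incseq G"
  proof (rule incseq_SucI)
    fix k
    have "1 / real (Suc (Suc k)) \<le> 1 / real (Suc k)" by (simp add: field_simps)
    then show "G k \<subseteq> G (Suc k)" unfolding G_def by (auto intro: le_less_trans)
  qed
  have le: "measure M (G k) \<le> measure N U" for k
  proof -
    have "measure M (G k) \<le> measure N (F k)"
    proof (rule field_le_epsilon)
      fix e :: real assume e: "e > 0"
      have "\<forall>\<^sub>F n in sequentially. frequency n x (G k) > measure M (G k) - e / 2"
        using assms(3) oG e by (auto simp: equidistributed_def)
      moreover have "\<forall>\<^sub>F n in sequentially. frequency n x (F k) < measure N (F k) + e / 2"
        using assms cF e by (intro equidistributed_closed) auto
      ultimately have "\<forall>\<^sub>F n in sequentially. measure M (G k) \<le> measure N (F k) + e"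
        by eventually_elim (use frequency_mono[OF GF] in \<open>smt (verit) field_sum_of_halves\<close>)
      then show "measure M (G k) \<le> measure N (F k) + e" by simp
    qed
    also have "\<dots> \<le> measure N U"
      using FU cF U assms(5) by (intro N.finite_measure_mono) auto
    finally show ?thesis .
  qed
  have "(\<lambda>k. measure M (G k)) \<longlonglongrightarrow> measure M (\<Union>k. G k)"
    using oG assms(2) by (intro M.finite_Lim_measure_incseq inc) auto
  then show ?thesis
    unfolding UG using le by (intro LIMSEQ_le_const2) auto
qed

lemma equidistributed_unique:
  fixes M N :: "'a::metric_space measure"
  assumes M: "prob_space M" "sets M = sets borel" "equidistributed M x"
    and N: "prob_space N" "sets N = sets borel" "equidistributed N x"
  shows "M = N"
proof (rule measure_eqI_generator_eq[where E = "{U. open U}" and \<Omega> = UNIV and A = "\<lambda>_. UNIV"])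
  interpret M: prob_space M by fact
  interpret N: prob_space N by fact
  show "emeasure M U = emeasure N U" if "U \<in> {U. open U}" for U
    using that equidistributed_open_le[OF M N] equidistributed_open_le[OF N M]
    by (simp add: M.emeasure_eq_measure N.emeasure_eq_measure order_antisym)
  show "emeasure M UNIV \<noteq> \<infinity>" by simp
  have "sets borel = sigma_sets UNIV {U :: 'a set. open U}"
    unfolding borel_def by (rule sets_measure_of) simp
  then show "sets M = sigma_sets UNIV {U. open U}" "sets N = sigma_sets UNIV {U. open U}"
    using M(2) N(2) by simp_all
qed (auto simp: Int_stable_def)

lemma equidistributed_image:
  assumes "sets M = sets borel" "continuous_on UNIV f" "equidistributed M x"
  shows "equidistributed (distr M borel f) (\<lambda>i. f (x i))"
proof -
  have f: "f \<in> measurable M borel"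
    using borel_measurable_continuous_onI[OF assms(2)] measurable_cong_sets[OF assms(1) refl] by blast
  have sp: "space M = UNIV" using sets_eq_imp_space_eq[OF assms(1)] by simp
  show ?thesis
    using assms(3) open_vimage[OF _ assms(2)]
    unfolding equidistributed_def frequency_image
    by (simp add: measure_distr[OF f] sp)
qed

text \<open>A nonempty open set has positive measure, so its frequencies cannot all vanish.\<close>

lemma equidistributed_dense:
  fixes M :: "'a::metric_space measure"
  assumes "prob_space M" "nondegenerate M" "equidistributed M x"
  shows "closure (range x) = UNIV"
proof -
  interpret prob_space M by fact
  have "range x \<inter> U \<noteq> {}" if U: "open U" "U \<noteq> {}" for U
  proof
    assume "range x \<inter> U = {}"
    then have z: "frequency n x U = 0" for n
      by (auto simp: frequency_def indicator_def)
    have pos: "measure M U > 0"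
      using assms(2) U by (simp add: nondegenerate_def emeasure_eq_measure zero_less_measure_iff)
    then have "\<forall>\<^sub>F n in sequentially. frequency n x U > measure M U - measure M U"
      using assms(3) U unfolding equidistributed_def by blast
    then show False by (simp add: z)
  qed
  then have "- closure (range x) = {}"
    by (metis closed_closure open_Compl closure_subset disjoint_eq_subset_Compl inf.commute double_complement)
  then show ?thesis by blast
qed

section \<open>Random sequences are equidistributed\<close>

lemma indep_vars_PiM_coordinates:
  assumes "prob_space M"
  shows "prob_space.indep_vars (\<Pi>\<^sub>M i\<in>(UNIV::nat set). M) (\<lambda>_. M) (\<lambda>i x. x i) UNIV"
proof -
  interpret prob_space M by fact
  interpret P: product_prob_space "\<lambda>_::nat. M" UNIV ..
  show ?thesis
    by (subst P.indep_vars_iff_distr_eq_PiM) (auto simp: P.PiM_component restrict_UNIV)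
qed

lemma distr_PiM_coordinate:
  assumes "prob_space M" and f: "f \<in> measurable M N"
  shows "distr (\<Pi>\<^sub>M i\<in>(UNIV::nat set). M) N (\<lambda>x. f (x i)) = distr M N f"
proof -
  interpret prob_space M by fact
  interpret P: product_prob_space "\<lambda>_::nat. M" UNIV ..
  have "distr (\<Pi>\<^sub>M i\<in>(UNIV::nat set). M) N (\<lambda>x. f (x i))
      = distr (distr (\<Pi>\<^sub>M i\<in>(UNIV::nat set). M) M (\<lambda>x. x i)) N f"
    using f by (subst distr_distr) (auto simp: comp_def)
  then show ?thesis by (simp add: P.PiM_component)
qed

text \<open>
  The strong law of large numbers for the event \<open>A\<close>.  Hoeffding's inequality makes the probability
  of a deviation by \<open>e\<close> after \<open>n\<close> draws decay geometrically in \<open>n\<close>, hence summable, and the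
  Borel-Cantelli lemma leaves only finitely many such deviations.
\<close>

lemma AE_frequency_tendsto:
  assumes "prob_space M" and A: "A \<in> sets M"
  shows "AE x in (\<Pi>\<^sub>M i\<in>(UNIV::nat set). M). (\<lambda>n. frequency n x A) \<longlonglongrightarrow> measure M A"
proof -
  interpret prob_space M by fact
  interpret P: product_prob_space "\<lambda>_::nat. M" UNIV ..
  let ?P = "\<Pi>\<^sub>M i\<in>(UNIV::nat set). M"
  let ?X = "\<lambda>i x. indicator A (x i) :: real"
  have meas [measurable]: "?X i \<in> borel_measurable ?P" for i
    using A by measurable
  have indep: "P.indep_vars (\<lambda>_. borel) ?X UNIV"
    using A by (intro P.indep_vars_compose2[OF indep_vars_PiM_coordinates[OF assms(1)]]) auto
  have dX: "distr ?P borel (?X i) = distr M borel (indicator A)" for i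
    using A by (intro distr_PiM_coordinate assms(1)) auto
  have EX: "P.expectation (?X 0) = measure M A"
  proof -
    have "P.expectation (?X 0) = integral\<^sup>L (distr ?P borel (?X 0)) (\<lambda>x. x)"
      by (subst integral_distr) auto
    also have "\<dots> = integral\<^sup>L M (indicator A)"
      unfolding dX using A by (subst integral_distr) auto
    finally show ?thesis using A by simp
  qed
  have bound: "P.prob {x \<in> space ?P. \<bar>frequency n x A - measure M A\<bar> \<ge> e} \<le> 2 * exp (- 2 * e\<^sup>2) ^ n"
    if e: "e > 0" for e n
  proof (cases "n = 0")
    case True
    then show ?thesis using P.prob_le_1 by (auto intro: order_trans[OF P.prob_le_1])
  next
    case False
    interpret H: Hoeffding_ineq_iid ?P "{..<n}" ?X "?X 0" 0 1 "measure M A"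
    proof unfold_locales
      show "P.indep_vars (\<lambda>_. borel) ?X {..<n}"
        by (rule P.indep_vars_subset[OF indep]) auto
    qed (use dX EX[symmetric] meas in auto)
    have "P.prob {x \<in> space ?P. \<bar>(\<Sum>i<n. ?X i x) / n - measure M A\<bar> \<ge> e} \<le> 2 * exp (- 2 * n * e\<^sup>2)"
      using H.Hoeffding_ineq_abs_ge'[of e] e False by (simp add: lessThan_empty_iff)
    also have "exp (- 2 * n * e\<^sup>2) = exp (- 2 * e\<^sup>2) ^ n"
      by (simp add: exp_of_nat_mult[symmetric] mult_ac)
    finally show ?thesis by (simp add: frequency_def)
  qed
  have meas_f [measurable]: "(\<lambda>x. frequency n x A) \<in> borel_measurable ?P" for n
    unfolding frequency_def by measurable
  have "AE x in ?P. \<forall>k. \<forall>\<^sub>F n in sequentially. \<bar>frequency n x A - measure M A\<bar> < 1 / real (Suc k)"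
    unfolding AE_all_countable
  proof
    fix k
    let ?e = "1 / real (Suc k)"
    let ?B = "\<lambda>n. {x \<in> space ?P. \<bar>frequency n x A - measure M A\<bar> \<ge> ?e}"
    have "summable (\<lambda>n. P.prob (?B n))"
    proof (rule summable_comparison_test')
      show "summable (\<lambda>n. 2 * exp (- 2 * ?e\<^sup>2) ^ n)"
        by (intro summable_mult summable_geometric) simp
    qed (use bound[of ?e] in auto)
    then have "AE x in ?P. \<forall>\<^sub>F n in sequentially. x \<in> space ?P - ?B n"
      by (intro borel_cantelli_AE1) (simp_all add: P.emeasure_eq_measure)
    then show "AE x in ?P. \<forall>\<^sub>F n in sequentially. \<bar>frequency n x A - measure M A\<bar> < ?e"
      by eventually_elim (auto elim!: eventually_mono)
  qed
  then show ?thesis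
  proof eventually_elim
    case (elim x)
    show ?case
    proof (rule tendstoI)
      fix e :: real assume "e > 0"
      then obtain k where k: "1 / real (Suc k) < e"
        using reals_Archimedean by (auto simp: inverse_eq_divide)
      from elim[rule_format, of k]
      show "\<forall>\<^sub>F n in sequentially. dist (frequency n x A) (measure M A) < e"
        by eventually_elim (use k in \<open>auto simp: dist_real_def\<close>)
    qed
  qed
qed

text \<open>
  Every open set is an increasing union of finite unions of basic sets, and by continuity of \<open>M\<close>
  one of these already has almost the full measure.  Convergence on the countably many finite
  unions thus yields the bound on all open sets at once.
\<close>

lemma equidistributed_if_frequency_tendsto:
  fixes M :: "'a::topological_space measure"
  assumes "prob_space M" "sets M = sets borel"
    and B: "countable B" "topological_basis B"
    and x: "\<And>F. finite F \<Longrightarrow> F \<subseteq> B \<Longrightarrow> (\<lambda>n. frequency n x (\<Union>F)) \<longlonglongrightarrow> measure M (\<Union>F)"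
  shows "equidistributed M x"
  unfolding equidistributed_def
proof (intro allI impI, elim conjE)
  interpret prob_space M by fact
  fix U :: "'a set" and e :: real assume "open U" and e: "e > 0"
  then obtain B' where B': "B' \<subseteq> B" "U = \<Union>B'"
    using B(2) by (auto simp: topological_basis_def)
  have "countable B'" using B' B(1) countable_subset by blast
  obtain F where F: "finite F" "F \<subseteq> B'" "measure M (\<Union>F) > measure M U - e"
  proof (cases "B' = {}")
    case True
    then show ?thesis using that[of "{}"] B' e by auto
  next
    case False
    define G where "G k = from_nat_into B' ` {..<k}" for k
    have rG: "(\<Union>k. G k) = B'"
      unfolding G_def image_UN[symmetric] UN_lessThan_UNIV
      by (rule range_from_nat_into[OF False \<open>countable B'\<close>])
    have G: "finite (G k)" "G k \<subseteq> B'" for k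
      using from_nat_into[OF False] by (auto simp: G_def)
    have "G k \<subseteq> sets M" for k
      using G(2)[of k] B'(1) topological_basis_open[OF B(2)] assms(2) by auto
    then have "\<Union>(G k) \<in> sets M" for k
      using G(1) by (intro sets.finite_Union) auto
    moreover have "incseq (\<lambda>k. \<Union>(G k))"
      by (rule incseq_SucI) (auto simp: G_def less_Suc_eq)
    ultimately have "(\<lambda>k. measure M (\<Union>(G k))) \<longlonglongrightarrow> measure M (\<Union>k. \<Union>(G k))"
      by (intro finite_Lim_measure_incseq) auto
    also have "(\<Union>k. \<Union>(G k)) = U" unfolding B'(2) rG[symmetric] by auto
    finally have "\<forall>\<^sub>F k in sequentially. measure M (\<Union>(G k)) > measure M U - e"
      by (rule order_tendstoD) (use e in simp)
    then obtain k where "measure M (\<Union>(G k)) > measure M U - e"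
      by (auto simp: eventually_sequentially)
    then show ?thesis using that G by blast
  qed
  have "(\<lambda>n. frequency n x (\<Union>F)) \<longlonglongrightarrow> measure M (\<Union>F)"
    using F B' by (intro x) auto
  then have "\<forall>\<^sub>F n in sequentially. frequency n x (\<Union>F) > measure M U - e"
    using F(3) by (rule order_tendstoD)
  then show "\<forall>\<^sub>F n in sequentially. frequency n x U > measure M U - e"
    by eventually_elim (use F B' in \<open>auto intro: less_le_trans frequency_mono\<close>)
qed

lemma AE_equidistributed:
  fixes M :: "'a::second_countable_topology measure"
  assumes "prob_space M" "sets M = sets borel"
  shows "AE x in (\<Pi>\<^sub>M i\<in>(UNIV::nat set). M). equidistributed M x"
proof -
  obtain B :: "'a set set" where B: "countable B" "topological_basis B"
    using ex_countable_basis by blast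
  have "countable {F. finite F \<and> F \<subseteq> B}"
    using countable_Collect_finite_subset[OF B(1)] by (simp add: conj_commute)
  moreover have "\<Union>F \<in> sets M" if "F \<subseteq> B" for F
    using that topological_basis_open[OF B(2)] assms(2) by (auto intro!: borel_open)
  ultimately have "AE x in (\<Pi>\<^sub>M i\<in>(UNIV::nat set). M). \<forall>F\<in>{F. finite F \<and> F \<subseteq> B}.
      (\<lambda>n. frequency n x (\<Union>F)) \<longlonglongrightarrow> measure M (\<Union>F)"
    by (subst AE_ball_countable) (auto intro: AE_frequency_tendsto[OF assms(1)])
  then show ?thesis
    by eventually_elim (auto intro: equidistributed_if_frequency_tendsto[OF assms B])
qed

section \<open>Almost sure points with a common image\<close>

text \<open>
  An almost sure property need not define a measurable set, but it contains a measurable set of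
  full measure, to which inner regularity applies.
\<close>

lemma AE_imp_compact:
  fixes M :: "'a::polish_space measure"
  assumes "prob_space M" "sets M = sets borel" "AE x in M. P x"
  obtains K where "compact K" "\<And>x. x \<in> K \<Longrightarrow> P x" "measure M K > 1 / 2"
proof -
  interpret prob_space M by fact
  obtain N where N: "{x \<in> space M. \<not> P x} \<subseteq> N" "emeasure M N = 0" "N \<in> sets M"
    using AE_E[OF assms(3)] by blast
  have sp: "space M = UNIV" using sets_eq_imp_space_eq[OF assms(2)] by simp
  have "- N \<in> sets borel" using N(3) unfolding assms(2) by (rule borel_comp)
  moreover have "emeasure M (- N) = 1"
    using N prob_compl[of N] by (simp add: sp Compl_eq_Diff_UNIV emeasure_eq_measure)
  ultimately have "(SUP K\<in>{K. K \<subseteq> - N \<and> compact K}. emeasure M K) = 1"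
    using inner_regular[OF assms(2)] by simp
  moreover have "ennreal (1 / 2) < 1"
    by (subst ennreal_1[symmetric], subst ennreal_less_iff) auto
  ultimately have "ennreal (1 / 2) < (SUP K\<in>{K. K \<subseteq> - N \<and> compact K}. emeasure M K)"
    by simp
  then obtain K where K: "K \<subseteq> - N" "compact K" "ennreal (1 / 2) < emeasure M K"
    by (auto simp: less_SUP_iff)
  have "measure M K > 1 / 2"
    using K(3) unfolding emeasure_eq_measure by (subst (asm) ennreal_less_iff) auto
  then show ?thesis using that[of K] K N(1) sp by blast
qed

text \<open>
  If \<open>f\<close> and \<open>g\<close> have the same distribution, almost sure properties of their arguments can be met at
  arguments with a common value.  The images of the sets where \<open>P\<close> and \<open>Q\<close> hold may fail to be
  measurable, so they are replaced by images of compact sets of measure above one half: these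
  images are compact, and disjoint ones would have total probability above one.
\<close>

lemma AE_common_value:
  fixes M :: "'a::polish_space measure" and N :: "'b::polish_space measure"
    and f :: "'a \<Rightarrow> 'c::t2_space" and g :: "'b \<Rightarrow> 'c"
  assumes M: "prob_space M" "sets M = sets borel" and N: "prob_space N" "sets N = sets borel"
    and f: "continuous_on UNIV f" and g: "continuous_on UNIV g"
    and eq: "\<And>C. compact C \<Longrightarrow> C \<subseteq> range f \<or> C \<subseteq> range g \<Longrightarrow> measure M (f -` C) = measure N (g -` C)"
    and P: "AE x in M. P x" and Q: "AE y in N. Q y"
  obtains x y where "P x" "Q y" "f x = g y"
proof -
  interpret M: prob_space M by fact
  interpret N: prob_space N by fact
  obtain K where K: "compact K" "\<And>x. x \<in> K \<Longrightarrow> P x" "measure M K > 1 / 2"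
    using AE_imp_compact[OF M P] by blast
  obtain L where L: "compact L" "\<And>x. x \<in> L \<Longrightarrow> Q x" "measure N L > 1 / 2"
    using AE_imp_compact[OF N Q] by blast
  have cpt: "compact (f ` K)" "compact (g ` L)"
    using K L f g by (auto intro!: compact_continuous_image intro: continuous_on_subset)
  then have sf: "f -` (f ` K) \<in> sets M" "f -` (g ` L) \<in> sets M" and sg: "g -` (g ` L) \<in> sets N"
    unfolding M(2) N(2)
    by (simp_all add: borel_closed closed_vimage compact_imp_closed f g)
  have "1 / 2 < measure M (f -` (f ` K))"
    using K(3) M.finite_measure_mono[OF _ sf(1), of K] by fastforce
  moreover have "1 / 2 < measure N (g -` (g ` L))"
    using L(3) N.finite_measure_mono[OF _ sg, of L] by fastforce
  then have "1 / 2 < measure M (f -` (g ` L))"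
    using eq[OF cpt(2)] image_mono[OF subset_UNIV] by metis
  ultimately have "f -` (f ` K) \<inter> f -` (g ` L) \<noteq> {}"
    using M.finite_measure_Union[OF sf] M.prob_le_1[of "f -` (f ` K) \<union> f -` (g ` L)"] by linarith
  then obtain z x y where "x \<in> K" "y \<in> L" "f z = f x" "f z = g y"
    by (force simp: vimage_def)
  then show ?thesis using that[of x y] K(2) L(2) by simp
qed

section \<open>Isometries from distance matrices\<close>

text \<open>
  The distance matrix makes \<open>x i \<mapsto> y i\<close> a well-defined isometry between dense sets.  Completeness of
  the target extends it to the whole space, and completeness of the source makes the extension onto.
\<close>

lemma isometry_extension:
  fixes x :: "nat \<Rightarrow> 'a::complete_space" and y :: "nat \<Rightarrow> 'b::complete_space"
  assumes x: "closure (range x) = UNIV" and y: "closure (range y) = UNIV"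
    and d: "distance_matrix x = distance_matrix y"
  obtains V where "surj V" "\<And>p q. dist (V p) (V q) = dist p q" "\<And>i. V (x i) = y i"
proof -
  have d: "dist (x i) (x j) = dist (y i) (y j)" for i j
    using d by (auto simp: distance_matrix_def fun_eq_iff)
  define f where "f p = y (SOME i. x i = p)" for p
  have f: "f (x i) = y i" for i
  proof -
    have "x (SOME j. x j = x i) = x i" by (rule someI) simp
    then have "dist (y (SOME j. x j = x i)) (y i) = 0" by (simp flip: d)
    then show ?thesis by (simp add: f_def)
  qed
  have "uniformly_continuous_on (range x) f"
    unfolding uniformly_continuous_on_def by (auto simp: f simp flip: d)
  then obtain V where V: "uniformly_continuous_on UNIV V" "\<And>p. p \<in> range x \<Longrightarrow> f p = V p"
    using uniformly_continuous_on_extension_on_closure[of "range x" f] x by metis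
  have Vx: "V (x i) = y i" for i using V(2)[of "x i"] by (simp add: f)
  have cV: "continuous_on UNIV V" using V(1) by (rule uniformly_continuous_imp_continuous)
  have iso: "dist (V p) (V q) = dist p q" for p q
  proof -
    let ?E = "{z. dist (V (fst z)) (V (snd z)) = dist (fst z) (snd z)}"
    have "closed ?E"
      by (intro closed_Collect_eq continuous_intros continuous_on_compose2[OF cV]) auto
    moreover have "range x \<times> range x \<subseteq> ?E" by (auto simp: Vx d)
    ultimately have "closure (range x \<times> range x) \<subseteq> ?E" by (rule closure_minimal[rotated])
    then have "UNIV \<subseteq> ?E" by (simp add: closure_Times x)
    then have "(p, q) \<in> ?E" by blast
    then show ?thesis by simp
  qed
  have "z \<in> range V" for z
  proof -
    have "z \<in> closure (range y)" by (simp add: y)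
    then obtain u where u: "\<And>n. u n \<in> range y" "u \<longlonglongrightarrow> z"
      by (auto simp: closure_sequential)
    have "\<forall>n. \<exists>k. u n = y k" using u(1) by blast
    then obtain k where k: "\<And>n. u n = y (k n)" by metis
    \<comment> \<open>The preimages of \<open>u\<close> among the \<open>x i\<close> form a Cauchy sequence, whose limit is sent to \<open>z\<close>.\<close>
    have "Cauchy u" using u(2) by (rule LIMSEQ_imp_Cauchy)
    then have "Cauchy (\<lambda>n. x (k n))" unfolding Cauchy_def k d .
    then obtain l where l: "(\<lambda>n. x (k n)) \<longlonglongrightarrow> l"
      by (auto simp: Cauchy_convergent_iff convergent_def)
    then have "(\<lambda>n. V (x (k n))) \<longlonglongrightarrow> V l"
      using continuous_on_tendsto_compose[OF cV] by auto
    moreover have "u = (\<lambda>n. V (x (k n)))" by (simp add: fun_eq_iff k Vx)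
    ultimately have "u \<longlonglongrightarrow> V l" by simp
    then have "z = V l" using u(2) LIMSEQ_unique by blast
    then show ?thesis by simp
  qed
  then have "surj V" by auto
  then show ?thesis using that iso Vx by blast
qed

section \<open>The matrix distribution as a complete invariant\<close>

lemma continuous_distance_matrix:
  "continuous_on UNIV (distance_matrix :: (nat \<Rightarrow> 'a::metric_space) \<Rightarrow> _)"
  unfolding distance_matrix_def
  by (intro continuous_on_coordinatewise_then_product continuous_intros)
     (auto intro: continuous_on_product_coordinates)

text \<open>
  Compact sets of matrices are Borel in the full product, which lets the image measure on the cone
  of distance matrices be evaluated without reference to the trace \<open>\<sigma>\<close>-algebra.
\<close>

lemma measure_matrix_distribution_compact:
  fixes C :: "(nat \<Rightarrow> nat \<Rightarrow> real) set"
  assumes "metric_triple \<mu>" "compact C" "C \<subseteq> distance_matrices"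
  shows "measure (matrix_distribution \<mu>) C = measure (\<Pi>\<^sub>M i\<in>UNIV. \<mu>) (distance_matrix -` C)"
proof -
  interpret metric_triple \<mu> by fact
  have "space \<mu> = UNIV" using sets_eq_imp_space_eq[OF sets_eq_borel] by simp
  then have sp: "space (\<Pi>\<^sub>M i\<in>(UNIV::nat set). \<mu>) = UNIV" by (simp add: space_PiM)
  have "C \<in> sets borel" using assms(2) by (simp add: borel_compact)
  then have "C \<in> sets distance_matrix_space"
    using assms(3) unfolding distance_matrix_space_def
    by (auto simp: sets_restrict_space image_iff intro!: exI[of _ C])
  then show ?thesis
    unfolding matrix_distribution_def
    by (subst measure_distr[OF measurable_distance_matrix]) (auto simp: sp)
qed

text \<open>
  Applying \<open>V\<close> to each coordinate preserves independence, so it carries the product of \<open>\<mu>\<close> to the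
  product of the image measure, while the distance matrix stays the same pointwise.
\<close>

lemma matrix_distribution_isometry_invariant:
  fixes \<mu> :: "'a::polish_space measure" and V :: "'a \<Rightarrow> 'b::polish_space"
  assumes "metric_triple \<mu>" and V: "\<And>p q. dist (V p) (V q) = dist p q"
  shows "matrix_distribution (distr \<mu> borel V) = matrix_distribution \<mu>"
proof -
  interpret metric_triple \<mu> by fact
  interpret P: product_prob_space "\<lambda>_::nat. \<mu>" UNIV ..
  have Vm: "V \<in> measurable \<mu> borel"
    using isometry_borel_measurable[OF V] measurable_cong_sets[OF sets_eq_borel refl] by blast
  let ?P = "\<Pi>\<^sub>M i\<in>(UNIV::nat set). \<mu>"
  interpret D: metric_triple "distr \<mu> borel V"
    by (intro metric_triple.intro metric_triple_axioms.intro prob_space_distr Vm) simp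
  have "P.indep_vars (\<lambda>_. borel) (\<lambda>i x. V (x i)) UNIV"
    by (rule P.indep_vars_compose2[OF indep_vars_PiM_coordinates[OF prob_space_axioms]]) (rule Vm)
  then have "distr ?P (\<Pi>\<^sub>M i\<in>UNIV. borel) (\<lambda>x i. V (x i))
      = (\<Pi>\<^sub>M i\<in>UNIV. distr ?P borel (\<lambda>x. V (x i)))"
    using Vm by (subst (asm) P.indep_vars_iff_distr_eq_PiM) (auto simp: restrict_UNIV)
  then have eq: "distr ?P (\<Pi>\<^sub>M i\<in>UNIV. borel) (\<lambda>x i. V (x i)) = (\<Pi>\<^sub>M i\<in>UNIV. distr \<mu> borel V)"
    by (simp add: distr_PiM_coordinate[OF prob_space_axioms Vm])
  have m: "distance_matrix \<in> measurable (\<Pi>\<^sub>M i\<in>(UNIV::nat set). (borel :: 'b measure)) distance_matrix_space"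
    using D.measurable_distance_matrix
    by (simp cong: measurable_cong_sets sets_PiM_cong)
  have mV: "(\<lambda>x i. V (x i)) \<in> measurable ?P (\<Pi>\<^sub>M i\<in>(UNIV::nat set). borel)"
    using Vm by (intro measurable_PiM_single') (auto simp: space_PiM)
  show ?thesis
    unfolding matrix_distribution_def eq[symmetric]
    by (subst distr_distr[OF m mV])
       (simp add: comp_def distance_matrix_def[abs_def] V)
qed

theorem theorem4:
  fixes \<mu>\<^sub>1 :: "'a::polish_space measure" and \<mu>\<^sub>2 :: "'b::polish_space measure"
  assumes "metric_triple \<mu>\<^sub>1" and "metric_triple \<mu>\<^sub>2"
    and "nondegenerate \<mu>\<^sub>1" and "nondegenerate \<mu>\<^sub>2"
  shows "equivalent_triples \<mu>\<^sub>1 \<mu>\<^sub>2 \<longleftrightarrow> matrix_distribution \<mu>\<^sub>1 = matrix_distribution \<mu>\<^sub>2"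
proof
  assume "equivalent_triples \<mu>\<^sub>1 \<mu>\<^sub>2"
  then show "matrix_distribution \<mu>\<^sub>1 = matrix_distribution \<mu>\<^sub>2"
    unfolding equivalent_triples_def using matrix_distribution_isometry_invariant[OF assms(1)] by metis
next
  assume eq: "matrix_distribution \<mu>\<^sub>1 = matrix_distribution \<mu>\<^sub>2"
  interpret M1: metric_triple \<mu>\<^sub>1 by fact
  interpret M2: metric_triple \<mu>\<^sub>2 by fact
  have borel1: "sets (\<Pi>\<^sub>M i\<in>(UNIV::nat set). \<mu>\<^sub>1) = sets borel"
    using sets_PiM_cong[OF refl M1.sets_eq_borel] sets_PiM_equal_borel by blast
  have borel2: "sets (\<Pi>\<^sub>M i\<in>(UNIV::nat set). \<mu>\<^sub>2) = sets borel"
    using sets_PiM_cong[OF refl M2.sets_eq_borel] sets_PiM_equal_borel by blast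
  have same: "measure (\<Pi>\<^sub>M i\<in>(UNIV::nat set). \<mu>\<^sub>1) (distance_matrix -` C)
      = measure (\<Pi>\<^sub>M i\<in>(UNIV::nat set). \<mu>\<^sub>2) (distance_matrix -` C)"
    if cpt: "compact C" and C: "C \<subseteq> range (distance_matrix :: (nat \<Rightarrow> 'a) \<Rightarrow> _)
      \<or> C \<subseteq> range (distance_matrix :: (nat \<Rightarrow> 'b) \<Rightarrow> _)" for C
  proof -
    have "range (distance_matrix :: (nat \<Rightarrow> 'a) \<Rightarrow> _) \<subseteq> distance_matrices"
      "range (distance_matrix :: (nat \<Rightarrow> 'b) \<Rightarrow> _) \<subseteq> distance_matrices"
      by (auto intro: distance_matrix_in_distance_matrices)
    then have sub: "C \<subseteq> distance_matrices"
      using C by blast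
    show ?thesis
      using measure_matrix_distribution_compact[OF assms(1) cpt sub]
        measure_matrix_distribution_compact[OF assms(2) cpt sub] eq by simp
  qed
  have prob1: "prob_space (\<Pi>\<^sub>M i\<in>(UNIV::nat set). \<mu>\<^sub>1)"
    by (intro prob_space_PiM M1.prob_space_axioms)
  have prob2: "prob_space (\<Pi>\<^sub>M i\<in>(UNIV::nat set). \<mu>\<^sub>2)"
    by (intro prob_space_PiM M2.prob_space_axioms)
  obtain x y where x: "equidistributed \<mu>\<^sub>1 x" and y: "equidistributed \<mu>\<^sub>2 y"
    and xy: "distance_matrix x = distance_matrix y"
    by (rule AE_common_value[OF prob1 borel1 prob2 borel2
          continuous_distance_matrix continuous_distance_matrix same
          AE_equidistributed[OF M1.prob_space_axioms M1.sets_eq_borel]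
          AE_equidistributed[OF M2.prob_space_axioms M2.sets_eq_borel]])
  obtain V where V: "surj V" "\<And>p q. dist (V p) (V q) = dist p q" "\<And>i. V (x i) = y i"
    using isometry_extension[OF _ _ xy] equidistributed_dense[OF M1.prob_space_axioms assms(3) x]
      equidistributed_dense[OF M2.prob_space_axioms assms(4) y] by blast
  have cV: "continuous_on UNIV V" by (auto simp: continuous_on_iff V(2))
  have Vm: "V \<in> measurable \<mu>\<^sub>1 borel"
    using isometry_borel_measurable[OF V(2)] measurable_cong_sets[OF M1.sets_eq_borel refl] by blast
  \<comment> \<open>Both the image of \<open>\<mu>\<^sub>1\<close> and \<open>\<mu>\<^sub>2\<close> can be read off from the one sequence \<open>y\<close>.\<close>
  have "equidistributed (distr \<mu>\<^sub>1 borel V) y"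
    using equidistributed_image[OF M1.sets_eq_borel cV x] by (simp add: V(3))
  then have "distr \<mu>\<^sub>1 borel V = \<mu>\<^sub>2"
    using equidistributed_unique[OF M1.prob_space_distr[OF Vm] _ _ M2.prob_space_axioms M2.sets_eq_borel y]
    by simp
  then show "equivalent_triples \<mu>\<^sub>1 \<mu>\<^sub>2"
    unfolding equivalent_triples_def using V by blast
qed

end
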